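(* Let $p\in(0,1]$ and, for each integer $k\ge 0$, let $L_{n,k}$ denote the number of vertices of out-degree $k$ in the $p$-percolated uniform temporal tree $\mathcal{T}_{n,p}$. Then, for every fixed $k\ge 0$, $$\frac{\mathbf{E}L_{n,k}}{e^{np}}\to 2^{-(k+1)}\quad\text{as } n\to\infty.$$
   Context: For a positive integer $n$, let $T_n$ be the rooted infinite complete $n$-ary tree (every vertex has exactly $n$ children). To each edge $e$ of $T_n$ assign an independent random variable $U_e$ uniformly distributed on $[0,1]$. The label $\ell_v$ of a non-root vertex $v$ is $U_e$, where $e$ is the edge joining $v$ to its parent. For $p\in(0,1]$, assign the root the label $p$. The $p$-percolated uniform temporal tree $\mathcal{T}_{n,p}$ is the random rooted tree obtained from $T_n$ by deleting all vertices $v$ for which the vertex labels along the path from the root to $v$ are not decreasing. (Thus a vertex $v$ of $T_n$ is kept exactly when the labels read along the path from the root to $v$, starting with the label $p$ of the root, are decreasing.) The tree is almost surely finite. The out-degree of a vertex in $\mathcal{T}_{n,p}$ is the number of its children in $\mathcal{T}_{n,p}$. *)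

theory Defs
  imports "HOL-Probability.Probability" "HOL-Library.Sublist"
begin

text \<open>
  A vertex of the complete n-ary tree is the finite sequence of child indices below n read along
  the path from the root, so the root is the empty list, the children of v are the lists
  v @ [i] with i < n, and the vertices on the path from the root to v are, in order, the members
  of the list prefixes v.
\<close>

definition nary_tree :: "nat \<Rightarrow> nat list set" where
  "nary_tree n = lists {..<n}"

text \<open>
  Every edge joins a unique non-root vertex to its parent and is represented by that vertex.
  An assignment of numbers to the edges is therefore a function u on lists, of which only the
  values on nary_edges n are relevant.
\<close>

definition nary_edges :: "nat \<Rightarrow> nat list set" where
  "nary_edges n = nary_tree n - {[]}"

definition vertex_label :: "real \<Rightarrow> (nat list \<Rightarrow> real) \<Rightarrow> nat list \<Rightarrow> real" where
  "vertex_label p u v = (if v = [] then p else u v)"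

text \<open>Decreasing means strictly decreasing; for independent uniform labels, allowing equalities
  would change the tree only on a null set.\<close>

definition temporal_tree :: "nat \<Rightarrow> real \<Rightarrow> (nat list \<Rightarrow> real) \<Rightarrow> nat list set" where
  "temporal_tree n p u =
     {v \<in> nary_tree n. sorted_wrt (>) (map (vertex_label p u) (prefixes v))}"

definition out_degree :: "nat \<Rightarrow> real \<Rightarrow> (nat list \<Rightarrow> real) \<Rightarrow> nat list \<Rightarrow> nat" where
  "out_degree n p u v = card {i. i < n \<and> v @ [i] \<in> temporal_tree n p u}"

text \<open>The tree is almost surely finite, so the convention that an infinite set has cardinality 0
  matters only on a null set.\<close>

definition num_out_degree :: "nat \<Rightarrow> real \<Rightarrow> nat \<Rightarrow> (nat list \<Rightarrow> real) \<Rightarrow> nat" where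
  "num_out_degree n p k u = card {v \<in> temporal_tree n p u. out_degree n p u v = k}"

text \<open>The family U on the probability space M labels the edges of the n-ary tree by independent
  random variables, each uniformly distributed on the unit interval.\<close>

definition uniform_edge_labels ::
    "'a measure \<Rightarrow> nat \<Rightarrow> (nat list \<Rightarrow> 'a \<Rightarrow> real) \<Rightarrow> bool" where
  "uniform_edge_labels M n U \<longleftrightarrow>
     prob_space M \<and>
     prob_space.indep_vars M (\<lambda>_. borel) U (nary_edges n) \<and>
     (\<forall>e\<in>nary_edges n. distr M borel (U e) = uniform_measure lborel {0..1})"

end

theory Submission imports Defs begin

text \<open>
  A vertex at depth \<open>m \<ge> 1\<close> survives with own label in \<open>dx\<close> when the \<open>m - 1\<close> labels above it fall
  into \<open>[x, p]\<close> in decreasing order, which has density \<open>(p - x)^(m-1) / (m-1)!\<close>. Given that label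
  \<open>x\<close>, each of its \<open>n\<close> children survives independently with probability \<open>x\<close>, so the out-degree is
  binomial and equals \<open>k\<close> with probability \<open>g(x) = (n choose k) x^k (1 - x)^(n-k)\<close>. There are \<open>n^m\<close>
  vertices at depth \<open>m\<close>, and summing over \<open>m\<close> turns the densities into an exponential series:
  the expected number of vertices of out-degree \<open>k\<close> is, the root contributing the first term,

    \<open>g(p) + \<integral>\<^sub>0\<^sup>p n exp(n (p - x)) g(x) dx\<close>.

  After division by \<open>exp(n p)\<close> the root term vanishes in the limit because \<open>g(p) \<le> 1\<close>. In the
  integral put \<open>x = y / n\<close>. It becomes the integral of \<open>exp(-y) g(y / n)\<close> over \<open>[0, n p]\<close>, where
  \<open>g(y / n)\<close> tends to the Poisson weight \<open>exp(-y) y^k / k!\<close>. The inequality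
  \<open>(n choose k) \<le> n^k / k!\<close> makes \<open>exp(-y) y^k / k!\<close> an integrable majorant, so by dominated
  convergence the limit is \<open>\<integral> exp(-2 y) y^k / k! dy = 2^-(k+1)\<close> over the half-line.

  The law of one vertex is \<open>emeasure_path_event\<close>, which exposes the edges of the path one at a
  time in a finite product space and so produces an iterated integral; \<open>iterated_integral_Suc\<close>
  and \<open>suminf_iterated_integral\<close> collapse these integrals over all depths,
  \<open>expectation_num_out_degree\<close> gives the expected number, and \<open>tendsto_integral_rescaled_mass\<close>
  is the passage to the limit.
\<close>

section \<open>Survival and out-degree as an event along a path\<close>

text \<open>
  The event that the labels along \<open>es\<close> decrease starting from the bound \<open>t\<close>, and that exactly \<open>k\<close>
  edges of \<open>C\<close> carry a label below the last one. The recursion passes on the label just read as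
  the next bound, so one step of it is one step of conditioning on the first edge of the path.
\<close>

primrec path_event ::
    "'e set \<Rightarrow> nat \<Rightarrow> ('e \<Rightarrow> real) \<Rightarrow> real \<Rightarrow> 'e list \<Rightarrow> bool" where
  "path_event C k u t [] \<longleftrightarrow> card {c\<in>C. u c < t} = k"
| "path_event C k u t (e # es) \<longleftrightarrow> u e < t \<and> path_event C k u (u e) es"

lemma path_event_iff_sorted:
  "path_event C k u t es \<longleftrightarrow>
     sorted_wrt (>) (t # map u es) \<and> card {c\<in>C. u c < last (t # map u es)} = k"
proof (induction es arbitrary: t)
  case (Cons e es)
  have "transp ((>) :: real \<Rightarrow> real \<Rightarrow> bool)"
    by (auto simp: transp_def)
  then show ?case
    unfolding path_event.simps Cons.IH list.map by (subst sorted_wrt2) auto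
qed simp

lemma sorted_wrt_greater_snoc:
  fixes xs :: "real list"
  assumes "xs \<noteq> []"
  shows "sorted_wrt (>) (xs @ [y]) \<longleftrightarrow> sorted_wrt (>) xs \<and> y < last xs"
proof -
  have "\<forall>x\<in>set xs. last xs \<le> x" if "sorted_wrt (>) xs"
  proof -
    have "xs = butlast xs @ [last xs]"
      using assms by simp
    then have "sorted_wrt (>) (butlast xs @ [last xs])"
      using that by simp
    then have "\<forall>x\<in>set (butlast xs). last xs < x"
      unfolding sorted_wrt_append by auto
    moreover have "set xs = insert (last xs) (set (butlast xs))"
      by (subst \<open>xs = butlast xs @ [last xs]\<close>) auto
    ultimately show ?thesis
      by auto
  qed
  then show ?thesis
    using assms by (auto simp: sorted_wrt_append intro: less_le_trans)
qed

text \<open>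
  Edges are named by their lower endpoints, so the edges above \<open>v\<close> are its nonempty prefixes.
\<close>

definition path_edges :: "nat list \<Rightarrow> nat list list" where
  "path_edges v = tl (prefixes v)"

definition child_edges :: "nat \<Rightarrow> nat list \<Rightarrow> nat list set" where
  "child_edges n v = (\<lambda>i. v @ [i]) ` {..<n}"

lemma prefixes_eq_Cons_path_edges: "prefixes v = [] # path_edges v"
  by (cases v) (simp_all add: path_edges_def)

lemma map_vertex_label_prefixes:
  "map (vertex_label p u) (prefixes v) = p # map u (path_edges v)"
proof -
  have "[] \<notin> set (path_edges v)"
    using distinct_prefixes[of v] by (simp add: prefixes_eq_Cons_path_edges)
  then show ?thesis
    by (auto simp: prefixes_eq_Cons_path_edges vertex_label_def)
qed

lemma length_path_edges: "length (path_edges v) = length v"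
  by (simp add: path_edges_def)

lemma distinct_path_edges: "distinct (path_edges v)"
  unfolding path_edges_def by (intro distinct_tl distinct_prefixes)

lemma finite_child_edges: "finite (child_edges n v)"
  by (simp add: child_edges_def)

lemma card_child_edges: "card (child_edges n v) = n"
  unfolding child_edges_def by (subst card_image) (auto simp: inj_on_def)

lemma set_path_edges: "set (path_edges v) = {w. prefix w v \<and> w \<noteq> []}"
  using distinct_prefixes[of v] set_prefixes_eq[of v] by (auto simp: prefixes_eq_Cons_path_edges)

lemma path_edges_disjoint_child_edges: "set (path_edges v) \<inter> child_edges n v = {}"
  by (auto simp: set_path_edges child_edges_def dest: prefix_length_le)

lemma path_child_edges_subset:
  assumes "v \<in> nary_tree n"
  shows "set (path_edges v) \<union> child_edges n v \<subseteq> nary_edges n"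
  using assms by (auto simp: set_path_edges child_edges_def nary_edges_def nary_tree_def prefix_def)

text \<open>
  Once the labels down to \<open>v\<close> decrease, a child of \<open>v\<close> survives precisely when its label is below
  that of \<open>v\<close>: the larger labels further up impose nothing new. Hence the pair of conditions
  involves only the finitely many edges on the path and below \<open>v\<close>.
\<close>

lemma temporal_tree_out_degree_iff_path_event:
  assumes "v \<in> nary_tree n"
  shows "v \<in> temporal_tree n p u \<and> out_degree n p u v = k \<longleftrightarrow>
         path_event (child_edges n v) k u p (path_edges v)"
proof -
  define xs where "xs = p # map u (path_edges v)"
  have mem: "v \<in> temporal_tree n p u \<longleftrightarrow> sorted_wrt (>) xs"
    using assms unfolding temporal_tree_def xs_def by (simp add: map_vertex_label_prefixes)
  have child: "v @ [i] \<in> temporal_tree n p u \<longleftrightarrow> u (v @ [i]) < last xs"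
    if "i < n" "sorted_wrt (>) xs" for i
  proof -
    have "map (vertex_label p u) (prefixes (v @ [i])) = xs @ [u (v @ [i])]"
      unfolding prefixes_snoc map_append map_vertex_label_prefixes xs_def
      by (simp add: vertex_label_def)
    moreover have "v @ [i] \<in> nary_tree n"
      using assms that by (auto simp: nary_tree_def)
    moreover have "xs \<noteq> []"
      by (simp add: xs_def)
    ultimately show ?thesis
      using that unfolding temporal_tree_def by (simp add: sorted_wrt_greater_snoc)
  qed
  have "out_degree n p u v = card {c \<in> child_edges n v. u c < last xs}"
    if "sorted_wrt (>) xs"
  proof -
    have "{c \<in> child_edges n v. u c < last xs} =
          (\<lambda>i. v @ [i]) ` {i. i < n \<and> v @ [i] \<in> temporal_tree n p u}"
      using child[OF _ that] by (auto simp: child_edges_def)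
    then show ?thesis
      unfolding out_degree_def by (simp add: card_image inj_on_def)
  qed
  with mem show ?thesis
    unfolding path_event_iff_sorted xs_def[symmetric] by auto
qed

lemma path_event_cong:
  assumes "\<And>e. e \<in> set es \<union> C \<Longrightarrow> u e = w e"
  shows "path_event C k u t es \<longleftrightarrow> path_event C k w t es"
  using assms
proof (induction es arbitrary: t)
  case Nil
  then have "{c\<in>C. u c < t} = {c\<in>C. w c < t}"
    by auto
  then show ?case
    by simp
qed simp

lemma measurable_path_event:
  assumes "finite C" and "\<And>e. e \<in> set es \<union> C \<Longrightarrow> (\<lambda>\<omega>. u \<omega> e) \<in> borel_measurable N"
    and "t \<in> borel_measurable N"
  shows "Measurable.pred N (\<lambda>\<omega>. path_event C k (u \<omega>) (t \<omega>) es)"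
  using assms(2,3)
proof (induction es arbitrary: t)
  case Nil
  note [measurable] = Nil(2)
  have [measurable]: "(\<lambda>\<omega>. u \<omega> c) \<in> borel_measurable N" if "c \<in> C" for c
    using Nil(1) that by simp
  have "card {c \<in> C. u \<omega> c < t \<omega>} = (\<Sum>c\<in>C. if u \<omega> c < t \<omega> then 1 else 0)" for \<omega>
    using \<open>finite C\<close> by (simp add: sum.If_cases Int_def)
  moreover have "Measurable.pred N (\<lambda>\<omega>. (\<Sum>c\<in>C. if u \<omega> c < t \<omega> then 1 else 0 :: nat) = k)"
    by measurable
  ultimately show ?case
    by simp
next
  case (Cons e es)
  note [measurable] = Cons.prems(2)
  have [measurable]: "(\<lambda>\<omega>. u \<omega> e) \<in> borel_measurable N"
    using Cons.prems(1) by simp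
  have [measurable]: "Measurable.pred N (\<lambda>\<omega>. path_event C k (u \<omega>) (u \<omega> e) es)"
    using Cons.prems(1) by (intro Cons.IH) auto
  show ?case
    unfolding path_event.simps by measurable
qed

section \<open>The law of a single vertex\<close>

abbreviation unit_uniform :: "real measure" where
  "unit_uniform \<equiv> uniform_measure lborel {0..1}"

lemma prob_space_unit_uniform: "prob_space unit_uniform"
  by (rule prob_space_uniform_measure) auto

lemma nn_integral_unit_uniform:
  assumes "f \<in> borel_measurable borel"
  shows "(\<integral>\<^sup>+x. f x \<partial>unit_uniform) = (\<integral>\<^sup>+x. f x * indicator {0..1} x \<partial>lborel)"
  using assms by (subst nn_integral_uniform_measure) (auto simp: divide_ennreal_def)

lemma emeasure_unit_uniform_less:
  assumes "0 \<le> t" "t \<le> 1"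
  shows "emeasure unit_uniform {..<t} = ennreal t" "emeasure unit_uniform {t..} = ennreal (1 - t)"
proof -
  have "{0..1} \<inter> {..<t} = {0..<t}" "{0..1} \<inter> {t..} = {t..1}"
    using assms by auto
  then show "emeasure unit_uniform {..<t} = ennreal t" "emeasure unit_uniform {t..} = ennreal (1 - t)"
    using assms by (simp_all add: divide_ennreal_def)
qed

definition binomial_mass :: "nat \<Rightarrow> nat \<Rightarrow> real \<Rightarrow> real" where
  "binomial_mass n k t = real (n choose k) * t ^ k * (1 - t) ^ (n - k)"

lemma binomial_mass_nonneg: "0 \<le> t \<Longrightarrow> t \<le> 1 \<Longrightarrow> 0 \<le> binomial_mass n k t"
  by (simp add: binomial_mass_def)

lemma binomial_mass_le_1:
  assumes "0 \<le> t" "t \<le> 1"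
  shows "binomial_mass n k t \<le> 1"
  using pmf_le_1[of "binomial_pmf n t" k] assms by (simp add: binomial_mass_def)

lemma borel_measurable_binomial_mass [measurable]: "binomial_mass n k \<in> borel_measurable borel"
  unfolding binomial_mass_def[abs_def] by measurable

text \<open>
  Independent uniform labels fall below \<open>t\<close> independently with probability \<open>t\<close>. Fixing the set \<open>D\<close>
  of edges whose label is below \<open>t\<close> cuts out a box, and the boxes for the \<open>k\<close>-element sets \<open>D\<close>
  partition the event.
\<close>

lemma emeasure_PiM_count_less:
  assumes "finite C" "0 \<le> t" "t \<le> 1"
  shows "emeasure (\<Pi>\<^sub>M c\<in>C. unit_uniform) {x \<in> space (\<Pi>\<^sub>M c\<in>C. unit_uniform). card {c\<in>C. x c < t} = k}
         = ennreal (binomial_mass (card C) k t)"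
proof -
  interpret nu: prob_space unit_uniform by (rule prob_space_unit_uniform)
  interpret product_sigma_finite "\<lambda>_::'a. unit_uniform" ..
  define P where "P = (\<Pi>\<^sub>M c\<in>C. unit_uniform)"
  define S where "S = {D. D \<subseteq> C \<and> card D = k}"
  define B where "B D = (\<Pi>\<^sub>E c\<in>C. if c \<in> D then {..<t} else {t..})" for D
  have [simp]: "finite S"
    using assms(1) by (simp add: S_def)
  have space: "space P = (\<Pi>\<^sub>E c\<in>C. UNIV)"
    by (simp add: P_def space_PiM)
  have B_iff: "x \<in> B D \<longleftrightarrow> x \<in> space P \<and> {c\<in>C. x c < t} = D" if "D \<subseteq> C" for x D
  proof -
    have "x c \<in> (if c \<in> D then {..<t} else {t..}) \<longleftrightarrow> (c \<in> D \<longleftrightarrow> x c < t)" for c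
      by (simp add: not_less)
    then have "x \<in> B D \<longleftrightarrow> x \<in> space P \<and> (\<forall>c\<in>C. c \<in> D \<longleftrightarrow> x c < t)"
      unfolding B_def space PiE_iff by (simp only:) blast
    moreover have "(\<forall>c\<in>C. c \<in> D \<longleftrightarrow> x c < t) \<longleftrightarrow> {c\<in>C. x c < t} = D"
      using that by blast
    ultimately show ?thesis
      by simp
  qed
  have event: "{x \<in> space P. card {c\<in>C. x c < t} = k} = (\<Union>D\<in>S. B D)"
  proof (intro set_eqI iffI)
    fix x assume x: "x \<in> {x \<in> space P. card {c\<in>C. x c < t} = k}"
    then have "{c\<in>C. x c < t} \<in> S" "x \<in> B {c\<in>C. x c < t}"
      by (simp_all add: S_def B_iff)
    then show "x \<in> (\<Union>D\<in>S. B D)"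
      by (rule UN_I)
  next
    fix x assume "x \<in> (\<Union>D\<in>S. B D)"
    then obtain D where D: "D \<subseteq> C" "card D = k" "x \<in> B D"
      unfolding S_def by blast
    then have "x \<in> space P" "{c\<in>C. x c < t} = D"
      by (simp_all add: B_iff)
    then show "x \<in> {x \<in> space P. card {c\<in>C. x c < t} = k}"
      using D by simp
  qed
  have "D = D'" if D: "D \<in> S" "D' \<in> S" and x: "x \<in> B D" "x \<in> B D'" for D D' x
  proof -
    have "{c\<in>C. x c < t} = D" "{c\<in>C. x c < t} = D'"
      using D x by (simp_all add: S_def B_iff)
    then show ?thesis
      by simp
  qed
  then have "disjoint_family_on B S"
    unfolding disjoint_family_on_def by blast
  moreover have "B ` S \<subseteq> sets P"
    unfolding B_def P_def using assms(1) by (auto intro!: sets_PiM_I_finite)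
  ultimately have "emeasure P (\<Union>D\<in>S. B D) = (\<Sum>D\<in>S. emeasure P (B D))"
    by (intro sum_emeasure[symmetric]) auto
  also have "\<dots> = (\<Sum>D\<in>S. ennreal (t ^ k * (1 - t) ^ (card C - k)))"
  proof (intro sum.cong refl)
    fix D assume "D \<in> S"
    then have D: "D \<subseteq> C" "card D = k" by (auto simp: S_def)
    have "emeasure P (B D) = (\<Prod>c\<in>C. emeasure unit_uniform (if c \<in> D then {..<t} else {t..}))"
      unfolding P_def B_def using assms(1) by (intro emeasure_PiM) auto
    also have "\<dots> = (\<Prod>c\<in>C. if c \<in> D then ennreal t else ennreal (1 - t))"
      using assms by (intro prod.cong refl) (auto simp only: emeasure_unit_uniform_less split: if_splits)
    also have "\<dots> = ennreal t ^ card D * ennreal (1 - t) ^ card (C - D)"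
    proof -
      have "C \<inter> {c. c \<in> D} = D" "C \<inter> - {c. c \<in> D} = C - D" using D by auto
      then show ?thesis using assms(1) by (simp add: prod.If_cases)
    qed
    also have "\<dots> = ennreal (t ^ k * (1 - t) ^ (card C - k))"
      using D assms by (simp add: card_Diff_subset finite_subset ennreal_power ennreal_mult)
    finally show "emeasure P (B D) = ennreal (t ^ k * (1 - t) ^ (card C - k))" .
  qed
  also have "\<dots> = ennreal (binomial_mass (card C) k t)"
    using assms n_subsets[OF assms(1), of k]
    by (simp add: S_def binomial_mass_def ennreal_mult ennreal_of_nat_eq_real_of_nat mult.assoc)
  finally show ?thesis
    unfolding P_def[symmetric] event .
qed

text \<open>
  For \<open>m \<ge> 1\<close> this is the integral of \<open>g y\<^sub>m\<close> over the simplex \<open>t \<ge> y\<^sub>1 \<ge> \<dots> \<ge> y\<^sub>m \<ge> 0\<close>, in which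
  \<open>y\<^sub>m\<close> plays the label of the lowest edge of a path of length \<open>m\<close>.
\<close>

primrec iterated_integral :: "(real \<Rightarrow> ennreal) \<Rightarrow> nat \<Rightarrow> real \<Rightarrow> ennreal" where
  "iterated_integral g 0 t = g t"
| "iterated_integral g (Suc m) t = (\<integral>\<^sup>+y. iterated_integral g m y * indicator {0..t} y \<partial>lborel)"

lemma measurable_indicator_Icc_upper [measurable]:
  "(\<lambda>(t, y). indicator {0..t} y :: ennreal) \<in> borel_measurable (borel \<Otimes>\<^sub>M (borel :: real measure))"
proof -
  have "(\<lambda>(t::real, y). indicator {0..t} y :: ennreal) = (\<lambda>x. if 0 \<le> snd x \<and> snd x \<le> fst x then 1 else 0)"
    by (auto simp: fun_eq_iff split: split_indicator)
  then show ?thesis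
    by (simp only:) measurable
qed

lemma borel_measurable_iterated_integral [measurable]:
  assumes [measurable]: "g \<in> borel_measurable borel"
  shows "iterated_integral g m \<in> borel_measurable borel"
proof (induction m)
  case (Suc m)
  note [measurable] = Suc
  have "(\<lambda>t. \<integral>\<^sup>+y. iterated_integral g m y * indicator {0..t} y \<partial>lborel) \<in> borel_measurable borel"
    by measurable
  then show ?case
    by (simp add: fun_eq_iff cong: measurable_cong)
qed simp

text \<open>
  Induction on the path: integrating out the label \<open>y\<close> of the first edge last, the remaining
  coordinates see the same event for the shorter path with bound \<open>y\<close>. This is one
  more integration over \<open>[0, t]\<close>; the upper end \<open>1\<close> of the uniform law does not interfere because
  \<open>t \<le> 1\<close>.
\<close>

lemma emeasure_path_event:
  assumes "finite C" "distinct es" "set es \<inter> C = {}" "0 \<le> t" "t \<le> 1"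
  shows "emeasure (\<Pi>\<^sub>M e\<in>set es \<union> C. unit_uniform)
           {x \<in> space (\<Pi>\<^sub>M e\<in>set es \<union> C. unit_uniform). path_event C k x t es}
         = iterated_integral (\<lambda>t. ennreal (binomial_mass (card C) k t)) (length es) t"
  using assms(2-5)
proof (induction es arbitrary: t)
  case Nil
  then show ?case
    using emeasure_PiM_count_less[OF assms(1)] by simp
next
  case (Cons e es)
  interpret nu: prob_space unit_uniform by (rule prob_space_unit_uniform)
  interpret product_sigma_finite "\<lambda>_::'a. unit_uniform" ..
  define E where "E = set es \<union> C"
  define P where "P I = (\<Pi>\<^sub>M e\<in>I. unit_uniform)" for I :: "'a set"
  define q where "q = iterated_integral (\<lambda>t. ennreal (binomial_mass (card C) k t)) (length es)"
  have E: "finite E" "e \<notin> E" "set (e # es) \<union> C = insert e E"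
    using Cons.prems assms(1) by (auto simp: E_def)
  have coord [measurable]: "(\<lambda>x. x c) \<in> borel_measurable (P I)" if "c \<in> I" for c and I :: "'a set"
  proof -
    have "(\<lambda>x. x c) \<in> measurable (P I) unit_uniform"
      unfolding P_def using that by (rule measurable_component_singleton)
    then show ?thesis
      by (simp cong: measurable_cong_sets)
  qed
  have pred [measurable]: "Measurable.pred (P (insert e E)) (\<lambda>x. path_event C k x t (e # es))"
    using assms(1) by (intro measurable_path_event coord) (auto simp: E_def)
  have q [measurable]: "q \<in> borel_measurable borel"
    unfolding q_def by measurable
  define A where "A = {x \<in> space (P (insert e E)). path_event C k x t (e # es)}"
  have A [measurable]: "A \<in> sets (P (insert e E))"
    using pred unfolding A_def by measurable
  have "emeasure (P (insert e E)) A = (\<integral>\<^sup>+x. indicator A x \<partial>P (insert e E))"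
    by simp
  also have "\<dots> = (\<integral>\<^sup>+y. \<integral>\<^sup>+x. indicator A (x(e := y)) \<partial>P E \<partial>unit_uniform)"
    using E A unfolding P_def by (intro product_nn_integral_insert_rev) auto
  also have "\<dots> = (\<integral>\<^sup>+y. emeasure (P E) {x \<in> space (P E). path_event C k x y es} *
                        indicator {..<t} y \<partial>unit_uniform)"
  proof (intro nn_integral_cong)
    fix y
    have event: "{x \<in> space (P E). path_event C k x y es} \<in> sets (P E)"
      using measurable_path_event[OF assms(1), of es "\<lambda>x. x" "P E" "\<lambda>_. y"] coord
      by (auto simp: E_def)
    have "indicator A (x(e := y)) =
          indicator {x \<in> space (P E). path_event C k x y es} x * (indicator {..<t} y :: ennreal)"
      if "x \<in> space (P E)" for x
    proof -
      have "path_event C k (x(e := y)) y es \<longleftrightarrow> path_event C k x y es"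
        using E(2) by (intro path_event_cong) (auto simp: E_def)
      moreover have "x(e := y) \<in> space (P (insert e E))"
        using that by (auto simp: P_def space_PiM PiE_iff extensional_def)
      ultimately show ?thesis
        using that by (auto simp: A_def split: split_indicator)
    qed
    then have "(\<integral>\<^sup>+x. indicator A (x(e := y)) \<partial>P E) =
        (\<integral>\<^sup>+x. indicator {x \<in> space (P E). path_event C k x y es} x * indicator {..<t} y \<partial>P E)"
      by (intro nn_integral_cong) simp
    also have "\<dots> = emeasure (P E) {x \<in> space (P E). path_event C k x y es} * indicator {..<t} y"
      using event by (subst nn_integral_multc) auto
    finally show "(\<integral>\<^sup>+x. indicator A (x(e := y)) \<partial>P E) = \<dots>" .
  qed
  also have "\<dots> = (\<integral>\<^sup>+y. q y * indicator {..<t} y \<partial>unit_uniform)"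
  proof (intro nn_integral_cong_AE AE_uniform_measureI AE_I2 impI)
    fix y :: real assume "y \<in> {0..1}"
    then have "emeasure (P E) {x \<in> space (P E). path_event C k x y es} = q y"
      using Cons.IH[of y] Cons.prems by (simp add: P_def E_def q_def)
    then show "emeasure (P E) {x \<in> space (P E). path_event C k x y es} * indicator {..<t} y =
               q y * indicator {..<t} y"
      by simp
  qed simp
  also have "\<dots> = (\<integral>\<^sup>+y. q y * indicator {..<t} y * indicator {0..1} y \<partial>lborel)"
    by (intro nn_integral_unit_uniform) measurable
  also have "\<dots> = (\<integral>\<^sup>+y. q y * indicator {0..t} y \<partial>lborel)"
    \<comment> \<open>The strict and the weak upper bound differ on a null set only.\<close>
    using Cons.prems AE_lborel_singleton[of t]
    by (intro nn_integral_cong_AE) (auto split: split_indicator)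
  finally show ?case
    unfolding A_def E(3) by (simp add: P_def q_def)
qed

section \<open>Summing the iterated integrals over all depths\<close>

lemma nn_integral_power_diff_Icc:
  fixes x t :: real
  assumes "x \<le> t"
  shows "(\<integral>\<^sup>+y. ennreal ((y - x) ^ m / fact m) * indicator {x..t} y \<partial>lborel) =
         ennreal ((t - x) ^ Suc m / fact (Suc m))"
proof -
  have "((\<lambda>y. (y - x) ^ Suc m / fact (Suc m)) has_real_derivative (y - x) ^ m / fact m) (at y)" for y
  proof -
    have "((\<lambda>y. (y - x) ^ Suc m / fact (Suc m)) has_real_derivative
           real (Suc m) * (y - x) ^ m / fact (Suc m)) (at y)"
      by (auto intro!: derivative_eq_intros simp del: fact_Suc power_Suc of_nat_Suc)
    then show ?thesis
      by (simp add: field_simps del: of_nat_Suc)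
  qed
  then have "(\<integral>\<^sup>+y. ennreal ((y - x) ^ m / fact m) * indicator {x..t} y \<partial>lborel) =
             ennreal ((t - x) ^ Suc m / fact (Suc m) - (x - x) ^ Suc m / fact (Suc m))"
    using assms by (intro nn_integral_FTC_Icc) (auto intro: has_field_derivative_at_within)
  then show ?thesis
    by simp
qed

text \<open>
  Cauchy's formula for repeated integration: exchanging the two integrals in the induction step
  leaves the elementary integral of \<open>(y - x)^m / m!\<close> over \<open>y\<close> in \<open>[x, t]\<close>.
\<close>

lemma iterated_integral_Suc:
  assumes [measurable]: "g \<in> borel_measurable borel"
  shows "iterated_integral g (Suc m) t =
         (\<integral>\<^sup>+x. ennreal ((t - x) ^ m / fact m) * g x * indicator {0..t} x \<partial>lborel)"
proof (induction m arbitrary: t)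
  case (Suc m)
  have "iterated_integral g (Suc (Suc m)) t =
      (\<integral>\<^sup>+y. (\<integral>\<^sup>+x. ennreal ((y - x) ^ m / fact m) * g x * indicator {0..y} x \<partial>lborel) * indicator {0..t} y \<partial>lborel)"
    by (subst iterated_integral.simps(2)) (simp only: Suc.IH)
  also have "\<dots> = (\<integral>\<^sup>+y. \<integral>\<^sup>+x. ennreal ((y - x) ^ m / fact m) * g x * indicator {0..y} x * indicator {0..t} y \<partial>lborel \<partial>lborel)"
    by (intro nn_integral_cong nn_integral_multc[symmetric]) measurable
  also have "\<dots> = (\<integral>\<^sup>+x. \<integral>\<^sup>+y. ennreal ((y - x) ^ m / fact m) * g x * indicator {0..y} x * indicator {0..t} y \<partial>lborel \<partial>lborel)"
    by (intro lborel_pair.Fubini') measurable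
  also have "\<dots> = (\<integral>\<^sup>+x. ennreal ((t - x) ^ Suc m / fact (Suc m)) * g x * indicator {0..t} x \<partial>lborel)"
  proof (intro nn_integral_cong)
    fix x
    have "(\<integral>\<^sup>+y. ennreal ((y - x) ^ m / fact m) * g x * indicator {0..y} x * indicator {0..t} y \<partial>lborel) =
        (\<integral>\<^sup>+y. (g x * indicator {0..t} x) * (ennreal ((y - x) ^ m / fact m) * indicator {x..t} y) \<partial>lborel)"
      by (intro nn_integral_cong) (auto simp: mult_ac split: split_indicator)
    also have "\<dots> = (g x * indicator {0..t} x) * (\<integral>\<^sup>+y. ennreal ((y - x) ^ m / fact m) * indicator {x..t} y \<partial>lborel)"
      by (intro nn_integral_cmult) measurable
    also have "\<dots> = ennreal ((t - x) ^ Suc m / fact (Suc m)) * g x * indicator {0..t} x"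
      using nn_integral_power_diff_Icc[of x t m]
      by (auto simp: mult_ac split: split_indicator simp del: fact_Suc power_Suc)
    finally show "(\<integral>\<^sup>+y. ennreal ((y - x) ^ m / fact m) * g x * indicator {0..y} x * indicator {0..t} y \<partial>lborel) = \<dots>" .
  qed
  finally show ?case .
qed simp

text \<open>
  By monotone convergence the weighted sum can be taken under the integral, where the kernels
  \<open>a^(m+1) (t - x)^m / m!\<close> add up to \<open>a exp(a (t - x))\<close>. The depth zero term has no integral and stays
  apart.
\<close>

lemma suminf_iterated_integral:
  fixes a :: real
  assumes [measurable]: "g \<in> borel_measurable borel" and a: "0 \<le> a"
  shows "(\<Sum>m. ennreal (a ^ m) * iterated_integral g m t) =
         g t + (\<integral>\<^sup>+x. ennreal (a * exp (a * (t - x))) * g x * indicator {0..t} x \<partial>lborel)"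
    (is "_ = g t + ?I")
proof -
  have "(\<Sum>m. ennreal (a ^ Suc m) * iterated_integral g (Suc m) t) =
        (\<Sum>m. \<integral>\<^sup>+x. ennreal (a ^ Suc m * ((t - x) ^ m / fact m)) * (g x * indicator {0..t} x) \<partial>lborel)"
  proof (intro suminf_cong)
    fix m
    have "ennreal (a ^ Suc m) * iterated_integral g (Suc m) t =
        (\<integral>\<^sup>+x. ennreal (a ^ Suc m) * (ennreal ((t - x) ^ m / fact m) * g x * indicator {0..t} x) \<partial>lborel)"
      unfolding iterated_integral_Suc[OF assms(1)] by (intro nn_integral_cmult[symmetric]) measurable
    also have "\<dots> = (\<integral>\<^sup>+x. ennreal (a ^ Suc m * ((t - x) ^ m / fact m)) * (g x * indicator {0..t} x) \<partial>lborel)"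
      using a by (intro nn_integral_cong)
        (auto split: split_indicator simp del: power_Suc simp flip: mult.assoc ennreal_mult)
    finally show "ennreal (a ^ Suc m) * iterated_integral g (Suc m) t = \<dots>" .
  qed
  also have "\<dots> = (\<integral>\<^sup>+x. (\<Sum>m. ennreal (a ^ Suc m * ((t - x) ^ m / fact m)) * (g x * indicator {0..t} x)) \<partial>lborel)"
    by (intro nn_integral_suminf[symmetric]) measurable
  also have "\<dots> = ?I"
  proof (intro nn_integral_cong)
    fix x
    show "(\<Sum>m. ennreal (a ^ Suc m * ((t - x) ^ m / fact m)) * (g x * indicator {0..t} x)) =
          ennreal (a * exp (a * (t - x))) * g x * indicator {0..t} x"
    proof (cases "x \<in> {0..t}")
      case True
      have "(\<lambda>m. a * ((a * (t - x)) ^ m /\<^sub>R fact m)) sums (a * exp (a * (t - x)))"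
        by (intro sums_mult exp_converges)
      then have "(\<lambda>m. a ^ Suc m * ((t - x) ^ m / fact m)) sums (a * exp (a * (t - x)))"
        by (simp add: power_mult_distrib divide_inverse mult_ac)
      then have "(\<Sum>m. ennreal (a ^ Suc m * ((t - x) ^ m / fact m))) = ennreal (a * exp (a * (t - x)))"
        using True a by (intro suminf_ennreal_eq) auto
      then show ?thesis
        using True by (simp add: ennreal_suminf_multc mult.assoc)
    qed simp
  qed
  finally have "(\<Sum>m. ennreal (a ^ Suc m) * iterated_integral g (Suc m) t) = ?I" .
  moreover have "(\<Sum>m. ennreal (a ^ m) * iterated_integral g m t) =
      (\<Sum>m. ennreal (a ^ (m + 1)) * iterated_integral g (m + 1) t) +
      (\<Sum>m<1. ennreal (a ^ m) * iterated_integral g m t)"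
    by (rule suminf_offset) auto
  ultimately show ?thesis
    by (simp add: add.commute)
qed

section \<open>The expected number of vertices of a given out-degree\<close>

text \<open>
  Independence and uniformity say that the labels of the finitely many relevant edges have the
  product law used above, so the probability can be computed in the product space.
\<close>

lemma emeasure_out_degree:
  fixes k :: nat
  assumes lab: "uniform_edge_labels M n U" and n: "1 \<le> n" and "0 \<le> p" "p \<le> 1" and v: "v \<in> nary_tree n"
  defines "A \<equiv> {\<omega> \<in> space M. v \<in> temporal_tree n p (\<lambda>e. U e \<omega>) \<and> out_degree n p (\<lambda>e. U e \<omega>) v = k}"
  shows "A \<in> sets M"
    and "emeasure M A = iterated_integral (\<lambda>t. ennreal (binomial_mass n k t)) (length v) p"
proof -
  interpret prob_space M
    using lab by (simp add: uniform_edge_labels_def)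
  define C where "C = child_edges n v"
  define es where "es = path_edges v"
  define E where "E = set es \<union> C"
  define P where "P = (\<Pi>\<^sub>M e\<in>E. unit_uniform)"
  have E: "E \<subseteq> nary_edges n"
    unfolding E_def es_def C_def by (rule path_child_edges_subset[OF v])
  have C: "finite C"
    by (simp add: C_def finite_child_edges)
  have indep: "indep_vars (\<lambda>_. borel) U E"
    using lab E by (auto simp: uniform_edge_labels_def intro: indep_vars_subset)
  then have rv: "U e \<in> borel_measurable M" if "e \<in> E" for e
    using that by (auto simp: indep_vars_def)
  have A: "A = {\<omega> \<in> space M. path_event C k (\<lambda>e. U e \<omega>) p es}"
    unfolding A_def C_def es_def temporal_tree_out_degree_iff_path_event[OF v] ..
  show "A \<in> sets M"
    using measurable_path_event[OF C, of es "\<lambda>\<omega> e. U e \<omega>" M "\<lambda>_. p"] rv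
    unfolding A by (simp add: E_def)
  show "emeasure M A = iterated_integral (\<lambda>t. ennreal (binomial_mass n k t)) (length v) p"
  proof -
    have "C \<noteq> {}"
      using n card_child_edges[of n v] by (auto simp: C_def)
    then have E_ne: "E \<noteq> {}"
      by (auto simp: E_def)
    define X where "X = (\<lambda>\<omega>. \<lambda>e\<in>E. U e \<omega>)"
    have "distr M (\<Pi>\<^sub>M e\<in>E. borel) X = (\<Pi>\<^sub>M e\<in>E. distr M borel (U e))"
      using indep_vars_iff_distr_eq_PiM'[OF E_ne, where M' = "\<lambda>_. borel" and X = U] rv indep by (simp add: X_def)
    also have "\<dots> = P"
      using lab E unfolding P_def by (intro PiM_cong) (auto simp: uniform_edge_labels_def)
    finally have distr: "distr M (\<Pi>\<^sub>M e\<in>E. borel) X = P" .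
    have X: "X \<in> measurable M (\<Pi>\<^sub>M e\<in>E. borel)"
      unfolding X_def using rv by (intro measurable_restrict)
    define B where "B = {x \<in> space P. path_event C k x p es}"
    have B: "B \<in> sets (\<Pi>\<^sub>M e\<in>E. borel)"
    proof -
      have "Measurable.pred (\<Pi>\<^sub>M e\<in>E. borel) (\<lambda>x. path_event C k x p es)"
        by (intro measurable_path_event[OF C] measurable_component_singleton) (auto simp: E_def)
      then show ?thesis
        unfolding B_def distr[symmetric] by simp
    qed
    have "path_event C k (X \<omega>) p es \<longleftrightarrow> path_event C k (\<lambda>e. U e \<omega>) p es" for \<omega>
      by (intro path_event_cong) (simp add: X_def E_def)
    then have "A = X -` B \<inter> space M"
      using measurable_space[OF X] unfolding A B_def distr[symmetric] by auto
    then have "emeasure M A = emeasure P B"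
      unfolding distr[symmetric] using X B by (simp add: emeasure_distr)
    also have "\<dots> = iterated_integral (\<lambda>t. ennreal (binomial_mass (card C) k t)) (length es) p"
      unfolding B_def P_def E_def using assms(3,4) C
      by (intro emeasure_path_event)
        (auto simp: es_def C_def distinct_path_edges path_edges_disjoint_child_edges)
    finally show ?thesis
      by (simp add: es_def C_def length_path_edges card_child_edges)
  qed
qed

lemma has_bochner_integral_erlang_density:
  assumes "0 < l"
  shows "has_bochner_integral lborel (erlang_density k l) 1"
  using assms nn_integral_erlang_ith_moment[OF assms, of k 0]
  by (intro has_bochner_integral_nn_integral) auto

text \<open>
  The integrand that remains of \<open>n exp(n (p - x)) g(x)\<close> on \<open>[0, p]\<close> after division by \<open>exp(n p)\<close>
  and the substitution \<open>x = y / n\<close>.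
\<close>

definition rescaled_mass :: "nat \<Rightarrow> real \<Rightarrow> nat \<Rightarrow> real \<Rightarrow> real" where
  "rescaled_mass n p k y = exp (- y) * binomial_mass n k (y / real n) * indicator {0..real n * p} y"

lemma borel_measurable_rescaled_mass [measurable]: "rescaled_mass n p k \<in> borel_measurable borel"
  unfolding rescaled_mass_def[abs_def] by measurable

text \<open>
  The majorant is \<open>exp(-y) y^k / k!\<close>, the Erlang density of rate 1: it comes from
  \<open>(n choose k) \<le> n^k / k!\<close> and from bounding \<open>(1 - y / n)^(n-k)\<close> by 1.
\<close>

lemma rescaled_mass_bounds:
  assumes "1 \<le> n" "0 \<le> p" "p \<le> 1"
  shows "0 \<le> rescaled_mass n p k y" "rescaled_mass n p k y \<le> erlang_density k 1 y"
proof -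
  have "0 \<le> rescaled_mass n p k y \<and> rescaled_mass n p k y \<le> erlang_density k 1 y"
  proof (cases "y \<in> {0..real n * p}")
    case True
    define s where "s = y / real n"
    have "y \<le> real n"
    proof -
      have "real n * p \<le> real n * 1"
        using assms by (intro mult_left_mono) auto
      then show ?thesis
        using True by simp
    qed
    then have s: "0 \<le> s" "s \<le> 1" "y = real n * s"
      using True assms by (auto simp: s_def)
    have "real (n choose k) * fact k \<le> real n ^ k"
      using binomial_fact_pow[of n k] by (metis of_nat_fact of_nat_le_iff of_nat_mult of_nat_power)
    then have "real (n choose k) * s ^ k \<le> (real n ^ k / fact k) * s ^ k"
      using s by (intro mult_right_mono) (auto simp: field_simps)
    also have "\<dots> = y ^ k / fact k"
      by (simp add: s(3) power_mult_distrib)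
    finally have "real (n choose k) * s ^ k * (1 - s) ^ (n - k) \<le> y ^ k / fact k * 1"
      using s True by (intro mult_mono power_le_one) auto
    then have "exp (- y) * binomial_mass n k s \<le> exp (- y) * (y ^ k / fact k)"
      unfolding binomial_mass_def by (intro mult_left_mono) auto
    moreover have "rescaled_mass n p k y = exp (- y) * binomial_mass n k s"
      using True by (simp add: rescaled_mass_def s_def)
    moreover have "erlang_density k 1 y = exp (- y) * (y ^ k / fact k)"
      using True by (simp add: erlang_density_def)
    moreover have "0 \<le> exp (- y) * binomial_mass n k s"
      using s by (simp add: binomial_mass_nonneg)
    ultimately show ?thesis
      by simp
  qed (auto simp: rescaled_mass_def)
  then show "0 \<le> rescaled_mass n p k y" "rescaled_mass n p k y \<le> erlang_density k 1 y"
    by auto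
qed

lemma integrable_rescaled_mass:
  assumes "1 \<le> n" "0 \<le> p" "p \<le> 1"
  shows "integrable lborel (rescaled_mass n p k)"
proof (rule Bochner_Integration.integrable_bound)
  show "integrable lborel (erlang_density k 1)"
    using has_bochner_integral_erlang_density[of 1 k] by (simp add: has_bochner_integral_iff)
  show "AE y in lborel. norm (rescaled_mass n p k y) \<le> norm (erlang_density k 1 y)"
    using rescaled_mass_bounds[OF assms] by (intro AE_I2) simp
qed simp

lemma nn_integral_rescale:
  assumes "1 \<le> n" "0 \<le> p" "p \<le> 1"
  shows "(\<integral>\<^sup>+x. ennreal (real n * exp (real n * (p - x))) * ennreal (binomial_mass n k x) *
                indicator {0..p} x \<partial>lborel) =
         ennreal (exp (real n * p) * (\<integral>y. rescaled_mass n p k y \<partial>lborel))"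
    (is "(\<integral>\<^sup>+x. ?f x \<partial>lborel) = _")
proof -
  have "(\<integral>\<^sup>+x. ?f x \<partial>lborel) = ennreal \<bar>1 / real n\<bar> * (\<integral>\<^sup>+y. ?f (0 + 1 / real n * y) \<partial>lborel)"
    using assms by (intro nn_integral_real_affine) auto
  also have "\<dots> = (\<integral>\<^sup>+y. ennreal \<bar>1 / real n\<bar> * ?f (0 + 1 / real n * y) \<partial>lborel)"
    by (intro nn_integral_cmult[symmetric]) measurable
  also have "\<dots> = (\<integral>\<^sup>+y. ennreal (exp (real n * p) * rescaled_mass n p k y) \<partial>lborel)"
  proof (intro nn_integral_cong)
    fix y
    have iff: "1 / real n * y \<in> {0..p} \<longleftrightarrow> y \<in> {0..real n * p}"
      using assms by (auto simp: field_simps zero_le_divide_iff)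
    have exp: "real n * exp (real n * (p - 1 / real n * y)) = real n * (exp (real n * p) * exp (- y))"
      using assms by (simp add: field_simps flip: exp_add)
    show "ennreal \<bar>1 / real n\<bar> * ?f (0 + 1 / real n * y) = ennreal (exp (real n * p) * rescaled_mass n p k y)"
    proof (cases "y \<in> {0..real n * p}")
      case True
      then have "0 \<le> y / real n \<and> y / real n \<le> p"
        using iff by simp
      then have "0 \<le> binomial_mass n k (y / real n)"
        using assms by (intro binomial_mass_nonneg) linarith+
      then show ?thesis
        using True iff assms unfolding exp add_0
        by (simp add: rescaled_mass_def exp flip: ennreal_mult)
    next
      case False
      then show ?thesis
        using iff by (simp add: rescaled_mass_def)
    qed
  qed
  also have "\<dots> = ennreal (\<integral>y. exp (real n * p) * rescaled_mass n p k y \<partial>lborel)"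
    using integrable_rescaled_mass[OF assms] rescaled_mass_bounds(1)[OF assms]
    by (intro nn_integral_eq_integral) auto
  finally show ?thesis
    by simp
qed

text \<open>
  The extended count \<open>Z\<close>, which takes the value \<open>\<infinity>\<close> on infinite sets, is a countable sum of
  indicators, so its integral is the sum of the probabilities over all vertices. This sum
  is finite, so \<open>Z\<close> is almost surely finite; and \<open>enn2real\<close> sends \<open>\<infinity>\<close> to 0, as does the cardinality
  of an infinite set, so \<open>enn2real \<circ> Z\<close> is the count itself at every point.
\<close>

lemma expectation_num_out_degree:
  assumes lab: "uniform_edge_labels M n U" and n: "1 \<le> n" and "0 \<le> p" "p \<le> 1"
  shows "prob_space.expectation M (\<lambda>\<omega>. real (num_out_degree n p k (\<lambda>e. U e \<omega>))) =
         binomial_mass n k p + exp (real n * p) * (\<integral>y. rescaled_mass n p k y \<partial>lborel)"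
    (is "_ = ?S")
proof -
  define g where "g t = ennreal (binomial_mass n k t)" for t
  define L where "L m = {v \<in> nary_tree n. length v = m}" for m
  define A where "A v = {\<omega> \<in> space M. v \<in> temporal_tree n p (\<lambda>e. U e \<omega>) \<and> out_degree n p (\<lambda>e. U e \<omega>) v = k}" for v
  define N where "N \<omega> = {v \<in> temporal_tree n p (\<lambda>e. U e \<omega>). out_degree n p (\<lambda>e. U e \<omega>) v = k}" for \<omega>
  define Z :: "_ \<Rightarrow> ennreal" where "Z \<omega> = (\<Sum>m. \<Sum>v\<in>L m. indicator (A v) \<omega>)" for \<omega>
  have L_lists: "L m = {v. set v \<subseteq> {..<n} \<and> length v = m}" for m
    by (auto simp: L_def nary_tree_def lists_eq_set)
  have L: "finite (L m)" "card (L m) = n ^ m" for m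
    unfolding L_lists by (auto simp: card_lists_length_eq intro: finite_lists_length_eq)
  have A [measurable]: "A v \<in> sets M" if "v \<in> L m" for v m
    using emeasure_out_degree(1)[OF lab n assms(3,4)] that by (auto simp: A_def L_def)
  have Z [measurable]: "Z \<in> borel_measurable M"
    unfolding Z_def by measurable
  have Z_eq: "Z \<omega> = emeasure (count_space UNIV) (N \<omega>)" if "\<omega> \<in> space M" for \<omega>
  proof -
    have "(\<Sum>v\<in>L m. indicator (A v) \<omega>) = emeasure (count_space UNIV) (N \<omega> \<inter> L m)" for m
    proof -
      have "(\<Sum>v\<in>L m. indicator (A v) \<omega> :: ennreal) = (\<Sum>v\<in>L m. if v \<in> N \<omega> then 1 else 0)"
        using that by (intro sum.cong) (auto simp: A_def N_def split: split_indicator)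
      also have "\<dots> = of_nat (card (N \<omega> \<inter> L m))"
        using L by (simp add: sum.If_cases Int_commute)
      also have "\<dots> = emeasure (count_space UNIV) (N \<omega> \<inter> L m)"
        using L by (subst emeasure_count_space_finite) auto
      finally show ?thesis .
    qed
    then have "Z \<omega> = (\<Sum>m. emeasure (count_space UNIV) (N \<omega> \<inter> L m))"
      by (simp add: Z_def)
    also have "\<dots> = emeasure (count_space UNIV) (\<Union>m. N \<omega> \<inter> L m)"
      by (intro suminf_emeasure) (auto simp: disjoint_family_on_def L_def)
    also have "(\<Union>m. N \<omega> \<inter> L m) = N \<omega>"
      by (auto simp: L_def N_def temporal_tree_def)
    finally show ?thesis .
  qed
  have card_N: "real (num_out_degree n p k (\<lambda>e. U e \<omega>)) = enn2real (Z \<omega>)" if "\<omega> \<in> space M" for \<omega>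
    using Z_eq[OF that] unfolding num_out_degree_def N_def[symmetric]
    by (cases "finite (N \<omega>)") (simp_all add: emeasure_count_space)
  have S: "0 \<le> ?S" "0 \<le> (\<integral>y. rescaled_mass n p k y \<partial>lborel)"
    using n assms(3,4)
    by (auto intro!: add_nonneg_nonneg mult_nonneg_nonneg binomial_mass_nonneg integral_nonneg_AE
        rescaled_mass_bounds)
  have int_Z: "(\<integral>\<^sup>+\<omega>. Z \<omega> \<partial>M) = ennreal ?S"
  proof -
    have "(\<integral>\<^sup>+\<omega>. Z \<omega> \<partial>M) = (\<Sum>m. \<integral>\<^sup>+\<omega>. (\<Sum>v\<in>L m. indicator (A v) \<omega>) \<partial>M)"
      unfolding Z_def by (intro nn_integral_suminf) measurable
    also have "\<dots> = (\<Sum>m. ennreal (real n ^ m) * iterated_integral g m p)"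
    proof (intro suminf_cong)
      fix m
      have "(\<integral>\<^sup>+\<omega>. (\<Sum>v\<in>L m. indicator (A v) \<omega>) \<partial>M) = (\<Sum>v\<in>L m. \<integral>\<^sup>+\<omega>. indicator (A v) \<omega> \<partial>M)"
        using A by (intro nn_integral_sum) auto
      also have "\<dots> = (\<Sum>v\<in>L m. iterated_integral g m p)"
      proof (intro sum.cong refl)
        fix v assume v: "v \<in> L m"
        then have "emeasure M (A v) = iterated_integral g m p"
          using emeasure_out_degree(2)[OF lab n assms(3,4), of v k]
          by (simp add: A_def g_def[abs_def] L_def)
        then show "(\<integral>\<^sup>+\<omega>. indicator (A v) \<omega> \<partial>M) = iterated_integral g m p"
          using A[OF v] by simp
      qed
      also have "\<dots> = ennreal (real n ^ m) * iterated_integral g m p"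
        using L by (simp add: ennreal_of_nat_eq_real_of_nat)
      finally show "(\<integral>\<^sup>+\<omega>. (\<Sum>v\<in>L m. indicator (A v) \<omega>) \<partial>M) = \<dots>" .
    qed
    also have "\<dots> = g p + (\<integral>\<^sup>+x. ennreal (real n * exp (real n * (p - x))) * g x *
                                    indicator {0..p} x \<partial>lborel)"
      by (intro suminf_iterated_integral) (simp_all add: g_def[abs_def])
    also have "\<dots> = ennreal ?S"
      unfolding g_def nn_integral_rescale[OF n assms(3,4)]
      using S assms(3,4) by (intro ennreal_plus[symmetric]) (auto intro: binomial_mass_nonneg)
    finally show ?thesis .
  qed
  have "AE \<omega> in M. Z \<omega> \<noteq> \<infinity>"
    using int_Z Z by (intro nn_integral_PInf_AE) auto
  then have "enn2real (\<integral>\<^sup>+\<omega>. Z \<omega> \<partial>M) = (\<integral>\<omega>. enn2real (Z \<omega>) \<partial>M)"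
    by (intro enn2real_nn_integral_eq_integral) (auto simp: less_top)
  also have "\<dots> = (\<integral>\<omega>. real (num_out_degree n p k (\<lambda>e. U e \<omega>)) \<partial>M)"
    using card_N by (intro Bochner_Integration.integral_cong) auto
  finally show ?thesis
    unfolding int_Z using S by simp
qed


section \<open>The Poisson limit and dominated convergence\<close>

lemma tendsto_binomial_over_power:
  "(\<lambda>n. real (n choose k) / real n ^ k) \<longlonglongrightarrow> 1 / fact k"
proof -
  have "(\<lambda>n. (\<Prod>i=0..<k. 1 - real i / real n) / fact k) \<longlonglongrightarrow> (\<Prod>i=0..<k. 1 - 0) / fact k"
    by (intro tendsto_intros lim_const_over_n) auto
  moreover have "\<forall>\<^sub>F n in sequentially.
      (\<Prod>i=0..<k. 1 - real i / real n) / fact k = real (n choose k) / real n ^ k"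
    using eventually_gt_at_top[of 0]
  proof eventually_elim
    case (elim n)
    have "real (n choose k) = (\<Prod>i=0..<k. real n - real i) / fact k"
      by (simp add: binomial_gbinomial gbinomial_prod_rev)
    moreover have "(\<Prod>i=0..<k. 1 - real i / real n) = (\<Prod>i=0..<k. (real n - real i) / real n)"
      using elim by (intro prod.cong) (auto simp: field_simps)
    ultimately show ?case
      by (simp add: prod_dividef)
  qed
  ultimately show ?thesis
    by (auto elim: Lim_transform_eventually)
qed

text \<open>
  The law of rare events. Writing \<open>(1 - y / n)^(n-k)\<close> as a quotient of an \<open>n\<close>-th power, which
  tends to \<open>exp(-y)\<close>, by a fixed power of a base tending to 1 avoids the varying exponent.
\<close>

lemma tendsto_binomial_mass_poisson:
  "(\<lambda>n. binomial_mass n k (y / real n)) \<longlonglongrightarrow> y ^ k / fact k * exp (- y)"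
proof -
  have "(\<lambda>n. (real (n choose k) / real n ^ k) * y ^ k * ((1 + (- y) / real n) ^ n / (1 - y / real n) ^ k))
      \<longlonglongrightarrow> (1 / fact k) * y ^ k * (exp (- y) / (1 - 0) ^ k)"
    by (intro tendsto_intros tendsto_binomial_over_power tendsto_exp_limit_sequentially lim_const_over_n) auto
  moreover have "\<forall>\<^sub>F n in sequentially.
      (real (n choose k) / real n ^ k) * y ^ k * ((1 + (- y) / real n) ^ n / (1 - y / real n) ^ k) =
      binomial_mass n k (y / real n)"
    using eventually_gt_at_top[of "max k (nat \<lceil>\<bar>y\<bar>\<rceil>)"]
  proof eventually_elim
    case (elim n)
    then have "\<bar>y\<bar> < real n" "k \<le> n"
      by linarith+
    then have "1 - y / real n \<noteq> 0"
      by (auto simp: field_simps)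
    then have "(1 - y / real n) ^ n / (1 - y / real n) ^ k = (1 - y / real n) ^ (n - k)"
      using \<open>k \<le> n\<close> by (simp add: power_diff)
    then show ?case
      by (simp add: binomial_mass_def power_divide)
  qed
  ultimately show ?thesis
    by (simp add: tendsto_cong)
qed

text \<open>
  The limit \<open>exp(-2 y) y^k / k!\<close> lacks only the factor \<open>2^(k+1)\<close> to be the Erlang density of rate 2;
  this factor is the source of the constant in the final limit.
\<close>

lemma tendsto_rescaled_mass:
  assumes "0 < p" "0 \<le> y"
  shows "(\<lambda>n. rescaled_mass n p k y) \<longlonglongrightarrow> erlang_density k 2 y / 2 ^ (k + 1)"
proof -
  have "(\<lambda>n. exp (- y) * binomial_mass n k (y / real n)) \<longlonglongrightarrow> exp (- y) * (y ^ k / fact k * exp (- y))"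
    by (intro tendsto_intros tendsto_binomial_mass_poisson)
  moreover have "\<forall>\<^sub>F n in sequentially. exp (- y) * binomial_mass n k (y / real n) = rescaled_mass n p k y"
    using eventually_ge_at_top[of "nat \<lceil>y / p\<rceil>"]
  proof eventually_elim
    case (elim n)
    then have "y \<le> real n * p"
      using assms by (simp add: field_simps nat_ceiling_le_eq)
    then show ?case
      using assms by (simp add: rescaled_mass_def)
  qed
  ultimately have "(\<lambda>n. rescaled_mass n p k y) \<longlonglongrightarrow> exp (- y) * (y ^ k / fact k * exp (- y))"
    by (rule Lim_transform_eventually)
  also have "exp (- y) * (y ^ k / fact k * exp (- y)) = erlang_density k 2 y / 2 ^ (k + 1)"
  proof -
    have "exp (- (2 * y)) = exp (- y) * exp (- y)"
      by (simp flip: exp_add)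
    then show ?thesis
      using assms by (simp add: erlang_density_def)
  qed
  finally show ?thesis .
qed

text \<open>
  The majorant does not depend on \<open>n\<close>, so dominated convergence applies; the sequence starts at
  \<open>Suc n\<close> because the bound needs \<open>n \<ge> 1\<close>.
\<close>

lemma tendsto_integral_rescaled_mass:
  assumes "0 < p" "p \<le> 1"
  shows "(\<lambda>n. \<integral>y. rescaled_mass n p k y \<partial>lborel) \<longlonglongrightarrow> 1 / 2 ^ (k + 1)"
proof -
  have "(\<lambda>n. \<integral>y. rescaled_mass (Suc n) p k y \<partial>lborel)
        \<longlonglongrightarrow> (\<integral>y. erlang_density k 2 y / 2 ^ (k + 1) \<partial>lborel)"
  proof (rule integral_dominated_convergence)
    show "integrable lborel (erlang_density k 1)"
      using has_bochner_integral_erlang_density[of 1 k] by (simp add: has_bochner_integral_iff)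
    show "AE y in lborel. (\<lambda>n. rescaled_mass (Suc n) p k y) \<longlonglongrightarrow> erlang_density k 2 y / 2 ^ (k + 1)"
    proof (intro AE_I2 LIMSEQ_Suc)
      fix y
      show "(\<lambda>n. rescaled_mass n p k y) \<longlonglongrightarrow> erlang_density k 2 y / 2 ^ (k + 1)"
      proof (cases "0 \<le> y")
        case False
        then show ?thesis
          by (simp add: rescaled_mass_def erlang_density_def)
      qed (use tendsto_rescaled_mass[OF assms(1)] in auto)
    qed
    show "AE y in lborel. norm (rescaled_mass (Suc n) p k y) \<le> erlang_density k 1 y" for n
      using rescaled_mass_bounds[of "Suc n" p k] assms by auto
  qed auto
  also have "(\<integral>y. erlang_density k 2 y / 2 ^ (k + 1) \<partial>lborel) = 1 / 2 ^ (k + 1)"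
    using has_bochner_integral_erlang_density[of 2 k] by (simp add: has_bochner_integral_iff)
  finally show ?thesis
    by (rule LIMSEQ_imp_Suc)
qed

theorem theorem2p4:
  fixes p :: real and k :: nat
    and M :: "nat \<Rightarrow> 'a measure"
    and U :: "nat \<Rightarrow> nat list \<Rightarrow> 'a \<Rightarrow> real"
  assumes "0 < p" and "p \<le> 1"
    and "\<And>n. 1 \<le> n \<Longrightarrow> uniform_edge_labels (M n) n (U n)"
  shows "(\<lambda>n. prob_space.expectation (M n)
                (\<lambda>\<omega>. real (num_out_degree n p k (\<lambda>e. U n e \<omega>))) / exp (real n * p))
           \<longlonglongrightarrow> 1 / 2 ^ (k + 1)"
proof -
  have "filterlim (\<lambda>n. real n * p) at_top sequentially"
    using assms(1) by (intro filterlim_at_top_mult_tendsto_pos[OF tendsto_const] filterlim_real_sequentially)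
  then have exp_lim: "(\<lambda>n. exp (- (real n * p))) \<longlonglongrightarrow> 0"
    by (intro filterlim_compose[OF exp_at_bot] filterlim_compose[OF filterlim_uminus_at_bot_at_top])
  have "(\<lambda>n. binomial_mass n k p * exp (- (real n * p))) \<longlonglongrightarrow> 0"
    using assms(1,2)
    by (intro tendsto_sandwich[OF _ _ tendsto_const exp_lim] always_eventually allI)
      (auto intro!: mult_nonneg_nonneg binomial_mass_nonneg simp: mult_le_cancel_right1 binomial_mass_le_1)
  then have "(\<lambda>n. binomial_mass n k p * exp (- (real n * p)) + (\<integral>y. rescaled_mass n p k y \<partial>lborel))
             \<longlonglongrightarrow> 0 + 1 / 2 ^ (k + 1)"
    using tendsto_integral_rescaled_mass[OF assms(1,2)] by (rule tendsto_add)
  moreover have "\<forall>\<^sub>F n in sequentially.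
      binomial_mass n k p * exp (- (real n * p)) + (\<integral>y. rescaled_mass n p k y \<partial>lborel) =
      prob_space.expectation (M n) (\<lambda>\<omega>. real (num_out_degree n p k (\<lambda>e. U n e \<omega>))) / exp (real n * p)"
    using eventually_ge_at_top[of 1]
  proof eventually_elim
    case (elim n)
    show ?case
      using assms(1,2) expectation_num_out_degree[OF assms(3)[OF elim] elim, of p k]
      by (simp add: exp_minus field_simps)
  qed
  ultimately show ?thesis
    by (auto elim: Lim_transform_eventually)
qed

end
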